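(* Let $n\ge 1$ and let $G=\mathbf{D}_{4n}$ be the dihedral group of order $8n$, with $\rho$ the rotation by $2\pi/(4n)$. Up to equivalence, the only homoclinic triples for $G$ are those of the form $(K,g,H)=(\mathbf{D}_q,\rho^r,\mathbf{D}_p)$ with $p,q$ positive integers and $r$ an integer, where for some reflection $\kappa\in G$ $$\mathbf{D}_q=\langle\kappa,\rho^{4n/q}\rangle,\qquad \mathbf{D}_p=\langle\kappa,\rho^{4n/p}\rangle,$$ satisfying (i) $q\mid n$; (ii) $t(r)\le t(n/q)$; (iii) $q\mid p$, $q\neq p$, $p\mid 2n$ and $r\equiv (2n/p) \pmod{4n/p}$. Here $t(m)$ denotes the multiplicity of $2$ in the prime decomposition of the integer $m$. Moreover, all such triples are homoclinic triples.
   Context: Notation: $A<B$ means that $A$ is a subgroup of $B$ (not necessarily proper); $H^g=gHg^{-1}$; $N_G(K)=\{g\in G: gK=Kg\}$. A homoclinic triple for a group $G$ is a triple $(K,g,H)$, where $K,H$ are subgroups of $G$ and $g\in G$, such that (HT1) $gH\cap N_G(K)=\emptyset$, and (HT2) $K<H\cap H^g$. Equivalence of homoclinic triples is the equivalence relation generated by conjugacy, $(K,g,H)\sim (K^f,fgf^{-1},H^f)$ for $f\in G$, and by $(K,g,H)\sim(K,\nu g,H)$ for $\nu\in N_G(K)$. For any $m\ge1$, $\mathbf{D}_m$ is the dihedral group of order $2m$ generated by a rotation $\rho$ of order $m$ and a reflection $\kappa$, with $\rho\kappa=\kappa\rho^{-1}$; a reflection is any element outside the rotation subgroup $\langle\rho\rangle$.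 In particular $\mathbf{D}_1=\langle\kappa\rangle\cong\mathbf{Z}_2$. *)

theory Defs
  imports "HOL-Algebra.Algebra" "HOL-Number_Theory.Cong"
begin

text \<open>
  \<open>dihedral_group G m \<rho> \<kappa>\<close>: \<open>G\<close> is the dihedral group of order \<open>2 * m\<close>, generated by a
  rotation \<open>\<rho>\<close> of order \<open>m\<close> and a reflection \<open>\<kappa>\<close>. The equation \<open>\<kappa> \<otimes> \<kappa> = \<one>\<close> is
  essential: without it the dicyclic groups would qualify as well.
\<close>

definition dihedral_group :: "('a, 'b) monoid_scheme \<Rightarrow> nat \<Rightarrow> 'a \<Rightarrow> 'a \<Rightarrow> bool" where
  "dihedral_group G m \<rho> \<kappa> \<longleftrightarrow>
     group G \<and> order G = 2 * m \<and> \<rho> \<in> carrier G \<and> \<kappa> \<in> carrier G \<and>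
     group.ord G \<rho> = m \<and> \<kappa> \<notin> generate G {\<rho>} \<and> \<kappa> \<otimes>\<^bsub>G\<^esub> \<kappa> = \<one>\<^bsub>G\<^esub> \<and>
     \<rho> \<otimes>\<^bsub>G\<^esub> \<kappa> = \<kappa> \<otimes>\<^bsub>G\<^esub> inv\<^bsub>G\<^esub> \<rho> \<and> generate G {\<rho>, \<kappa>} = carrier G"

definition reflections :: "('a, 'b) monoid_scheme \<Rightarrow> 'a \<Rightarrow> 'a set" where
  "reflections G \<rho> = carrier G - generate G {\<rho>}"

definition conj_set :: "('a, 'b) monoid_scheme \<Rightarrow> 'a \<Rightarrow> 'a set \<Rightarrow> 'a set" where
  "conj_set G g H = (g <#\<^bsub>G\<^esub> H) #>\<^bsub>G\<^esub> inv\<^bsub>G\<^esub> g"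

text \<open>
  The condition \<open>K < H \<inter> H\<^sup>g\<close> (``is a subgroup of'', not necessarily proper) is an inclusion
  of sets, because \<open>K\<close> and \<open>H\<close> are already required to be subgroups of \<open>G\<close>.
\<close>

definition homoclinic_triple ::
    "('a, 'b) monoid_scheme \<Rightarrow> 'a set \<times> 'a \<times> 'a set \<Rightarrow> bool" where
  "homoclinic_triple G = (\<lambda>(K, g, H).
     subgroup K G \<and> subgroup H G \<and> g \<in> carrier G \<and>
     (g <#\<^bsub>G\<^esub> H) \<inter> normalizer G K = {} \<and>
     K \<subseteq> H \<inter> conj_set G g H)"

inductive homoclinic_step ::
    "('a, 'b) monoid_scheme \<Rightarrow> 'a set \<times> 'a \<times> 'a set \<Rightarrow> 'a set \<times> 'a \<times> 'a set \<Rightarrow> bool"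
  for G (structure) where
  conjugacy: "\<lbrakk>homoclinic_triple G (K, g, H); f \<in> carrier G\<rbrakk> \<Longrightarrow>
     homoclinic_step G (K, g, H) (conj_set G f K, f \<otimes> g \<otimes> inv f, conj_set G f H)"
| normalizer_mult: "\<lbrakk>homoclinic_triple G (K, g, H); \<nu> \<in> normalizer G K\<rbrakk> \<Longrightarrow>
     homoclinic_step G (K, g, H) (K, \<nu> \<otimes> g, H)"

definition homoclinic_equiv ::
    "('a, 'b) monoid_scheme \<Rightarrow> 'a set \<times> 'a \<times> 'a set \<Rightarrow> 'a set \<times> 'a \<times> 'a set \<Rightarrow> bool" where
  "homoclinic_equiv G = equivclp (homoclinic_step G)"

text \<open>
  The subgroup \<open>D\<^sub>q = \<langle>\<kappa>, \<rho>\<^bsup>m/q\<^esup>\<rangle>\<close> of the dihedral group of order \<open>2 * m\<close>,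
  for a divisor \<open>q\<close> of \<open>m\<close>.
\<close>

definition dihedral_subgroup ::
    "('a, 'b) monoid_scheme \<Rightarrow> nat \<Rightarrow> 'a \<Rightarrow> 'a \<Rightarrow> nat \<Rightarrow> 'a set" where
  "dihedral_subgroup G m \<rho> \<kappa> q = generate G {\<kappa>, \<rho> [^]\<^bsub>G\<^esub> (m div q)}"

text \<open>
  The divisions below are exact: \<open>q\<close> divides \<open>n\<close> and \<open>p\<close> divides \<open>2 * n\<close>. The congruence
  excludes \<open>r = 0\<close>, where \<^const>\<open>multiplicity\<close> has only a conventional value.
\<close>

definition standard_triples ::
    "('a, 'b) monoid_scheme \<Rightarrow> nat \<Rightarrow> 'a \<Rightarrow> ('a set \<times> 'a \<times> 'a set) set" where
  "standard_triples G n \<rho> =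
     {(dihedral_subgroup G (4 * n) \<rho> \<kappa> q, \<rho> [^]\<^bsub>G\<^esub> r, dihedral_subgroup G (4 * n) \<rho> \<kappa> p)
      | \<kappa> (p :: nat) (q :: nat) (r :: int).
        \<kappa> \<in> reflections G \<rho> \<and> p > 0 \<and> q > 0 \<and>
        q dvd n \<and>
        multiplicity 2 r \<le> multiplicity 2 (n div q) \<and>
        q dvd p \<and> q \<noteq> p \<and> p dvd 2 * n \<and> [r = int (2 * n div p)] (mod int (4 * n div p))}"

text \<open>
  Dihedral groups exist for every \<open>m \<ge> 1\<close>: the pair \<open>(a, s)\<close> stands for \<open>\<rho>\<^bsup>a\<^esup>\<close> if \<open>s\<close> is
  false and for \<open>\<rho>\<^bsup>a\<^esup> \<otimes> \<kappa>\<close> otherwise.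
\<close>

definition dihedral_model :: "nat \<Rightarrow> (int \<times> bool) monoid" where
  "dihedral_model m =
     \<lparr>carrier = {0..<int m} \<times> UNIV,
      monoid.mult = (\<lambda>(a, s) (b, t). ((if s then a - b else a + b) mod int m, s \<noteq> t)),
      monoid.one = (0, False)\<rparr>"

lemma group_dihedral_model:
  assumes "m \<ge> 1"
  shows "group (dihedral_model m)"
proof (rule groupI)
  fix x assume x: "x \<in> carrier (dihedral_model m)"
  obtain a s where [simp]: "x = (a, s)" by (cases x)
  show "\<exists>y\<in>carrier (dihedral_model m). y \<otimes>\<^bsub>dihedral_model m\<^esub> x = \<one>\<^bsub>dihedral_model m\<^esub>"
    using x assms
    by (intro bexI[of _ "(if s then a else (- a) mod int m, s)"])
       (auto simp: dihedral_model_def mod_simps)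
qed (use assms in \<open>auto simp: dihedral_model_def mod_simps algebra_simps\<close>)

lemma dihedral_group_dihedral_model:
  assumes m: "m \<ge> 1"
  shows "dihedral_group (dihedral_model m) m (1 mod int m, False) (0, True)"
proof -
  let ?G = "dihedral_model m" and ?\<rho> = "(1 mod int m, False)" and ?\<kappa> = "(0 :: int, True)"
  interpret group ?G by (rule group_dihedral_model[OF m])
  have \<rho>: "?\<rho> \<in> carrier ?G" and \<kappa>: "?\<kappa> \<in> carrier ?G"
    using m by (auto simp: dihedral_model_def)
  have pow: "?\<rho> [^]\<^bsub>?G\<^esub> k = (int k mod int m, False)" for k :: nat
    by (induction k) (auto simp: dihedral_model_def mod_simps algebra_simps)
  have "ord ?\<rho> dvd k \<longleftrightarrow> m dvd k" for k
    unfolding pow_eq_id[OF \<rho>, symmetric] pow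
    by (auto simp: dihedral_model_def simp flip: zmod_int)
  hence ord: "ord ?\<rho> = m"
    by (meson dvd_antisym dvd_refl)
  have inv\<rho>: "inv\<^bsub>?G\<^esub> ?\<rho> = ((- 1) mod int m, False)"
    by (rule inv_equality) (use m in \<open>auto simp: dihedral_model_def mod_simps\<close>)
  have gen: "generate ?G {?\<rho>} \<subseteq> {x. \<not> snd x}"
    unfolding generate_pow[OF \<rho>] int_pow_def2
  proof safe
    fix k :: int and a b assume "(a, b) = (if k < 0 then inv\<^bsub>?G\<^esub> (?\<rho> [^]\<^bsub>?G\<^esub> nat (- k)) else ?\<rho> [^]\<^bsub>?G\<^esub> nat k)"
      and "snd (a, b)"
    moreover have "inv\<^bsub>?G\<^esub> (j mod int m, False) = ((- j) mod int m, False)" for j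
      by (rule inv_equality) (use m in \<open>auto simp: dihedral_model_def mod_simps\<close>)
    ultimately show False by (auto simp: pow split: if_splits)
  qed
  have sub: "subgroup (generate ?G {?\<rho>, ?\<kappa>}) ?G"
    by (rule generate_is_subgroup) (use \<rho> \<kappa> in auto)
  have "x \<in> generate ?G {?\<rho>, ?\<kappa>}" if x: "x \<in> carrier ?G" for x
  proof -
    obtain a s where as: "x = (a, s)" by (cases x)
    have r: "?\<rho> \<in> generate ?G {?\<rho>, ?\<kappa>}" and k: "?\<kappa> \<in> generate ?G {?\<rho>, ?\<kappa>}"
      by (auto intro: generate.incl)
    have "?\<rho> [^]\<^bsub>?G\<^esub> k \<in> generate ?G {?\<rho>, ?\<kappa>}" for k :: nat
      by (induction k) (auto intro: r subgroup.one_closed[OF sub] subgroup.m_closed[OF sub])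
    from this[of "nat a"] have a: "(a, False) \<in> generate ?G {?\<rho>, ?\<kappa>}"
      using x unfolding pow as by (auto simp: dihedral_model_def)
    have "(a, True) = (a, False) \<otimes>\<^bsub>?G\<^esub> ?\<kappa>"
      using x unfolding as by (auto simp: dihedral_model_def)
    with a k show ?thesis
      unfolding as by (cases s) (auto intro: subgroup.m_closed[OF sub])
  qed
  hence "generate ?G {?\<rho>, ?\<kappa>} = carrier ?G"
    using subgroup.subset[OF sub] by blast
  moreover have "order ?G = 2 * m"
    by (simp add: order_def dihedral_model_def card_cartesian_product)
  moreover have "?\<rho> \<otimes>\<^bsub>?G\<^esub> ?\<kappa> = ?\<kappa> \<otimes>\<^bsub>?G\<^esub> inv\<^bsub>?G\<^esub> ?\<rho>"
    unfolding inv\<rho> by (auto simp: dihedral_model_def mod_simps)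
  moreover have "?\<kappa> \<otimes>\<^bsub>?G\<^esub> ?\<kappa> = \<one>\<^bsub>?G\<^esub>"
    by (auto simp: dihedral_model_def)
  ultimately show ?thesis
    unfolding dihedral_group_def using \<rho> \<kappa> ord gen is_group by auto
qed

end

theory Submission
  imports Defs
begin

text \<open>
  In a homoclinic triple \<open>(K, g, H)\<close> the subgroup \<open>K\<close> contains a reflection \<open>\<kappa>\<close>, since a group of
  rotations is normal. Hence \<open>K = \<langle>\<kappa>, \<rho>\<^sup>d\<rangle>\<close> and \<open>H = \<langle>\<kappa>, \<rho>\<^sup>e\<rangle>\<close> with \<open>d = 4n/q\<close>, \<open>e = 4n/p\<close>, and left
  multiplication of \<open>g\<close> by \<open>\<kappa> \<in> N(K)\<close> makes \<open>g = \<rho>\<^sup>r\<close> a rotation. As \<open>\<rho>\<^sup>a\<close> normalizes \<open>K\<close> iff \<open>d\<close>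
  divides \<open>2a\<close>, the two conditions become: \<open>e\<close> divides \<open>d\<close> and \<open>2r\<close>, and no \<open>a \<equiv> r\<close> modulo \<open>e\<close> has
  \<open>d\<close> dividing \<open>2a\<close>. The case \<open>a = 0\<close> forces \<open>r\<close> to be an odd multiple of \<open>e/2\<close>; what remains says that
  \<open>p/q\<close> is even, and because \<open>t(r) = t(n/q) + 1 - t(p/q)\<close> this is condition (ii).
\<close>

section \<open>Conjugates, normalizers and homoclinic triples in an arbitrary group\<close>

lemma (in group) conj_set_eq_image: "conj_set G x H = (\<lambda>h. x \<otimes> h \<otimes> inv x) ` H"
  by (auto simp: conj_set_def l_coset_def r_coset_def)

lemma (in group) mem_normalizer_iff:
  assumes "H \<subseteq> carrier G"
  shows "x \<in> normalizer G H \<longleftrightarrow> x \<in> carrier G \<and> conj_set G x H = H"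
  using assms by (auto simp: normalizer_def stabilizer_def conj_set_def)

lemma (in group) subgroup_subset_normalizer:
  assumes "subgroup H G"
  shows "H \<subseteq> normalizer G H"
  using subgroup.subset[OF normal_imp_subgroup[OF subgroup_in_normalizer[OF assms]]] by simp

text \<open>A step of the equivalence assumes only that its source is homoclinic. The target
  inherits (HT1) because \<open>normalizer G K\<close> is a subgroup, and (HT2) because conjugation
  by \<open>\<nu>\<close> maps \<open>K\<close> to itself.\<close>

lemma (in group) homoclinic_triple_normalizer_mult:
  assumes hom: "homoclinic_triple G (K, g, H)" and \<nu>: "\<nu> \<in> normalizer G K"
  shows "homoclinic_triple G (K, \<nu> \<otimes> g, H)"
proof -
  have K: "subgroup K G" and H: "subgroup H G" and g: "g \<in> carrier G"
    and disj: "(g <# H) \<inter> normalizer G K = {}" and KH: "K \<subseteq> H" and Kg: "K \<subseteq> conj_set G g H"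
    using hom by (auto simp: homoclinic_triple_def)
  have norm: "subgroup (normalizer G K) G"
    using subgroup.subset[OF K] by (rule normalizer_imp_subgroup)
  have \<nu>_closed: "\<nu> \<in> carrier G" and conj_K: "conj_set G \<nu> K = K"
    using \<nu> mem_normalizer_iff subgroup.subset[OF K] by auto
  have "\<nu> \<otimes> g \<otimes> h \<notin> normalizer G K" if "h \<in> H" for h
  proof
    assume "\<nu> \<otimes> g \<otimes> h \<in> normalizer G K"
    hence "inv \<nu> \<otimes> (\<nu> \<otimes> g \<otimes> h) \<in> normalizer G K"
      by (rule subgroup.m_closed[OF norm subgroup.m_inv_closed[OF norm \<nu>]])
    moreover have "inv \<nu> \<otimes> (\<nu> \<otimes> g \<otimes> h) = g \<otimes> h"
      using \<nu>_closed g subgroup.mem_carrier[OF H that] by (simp add: inv_solve_left' m_assoc)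
    ultimately show False
      using disj that by (auto simp: l_coset_def)
  qed
  hence "(\<nu> \<otimes> g <# H) \<inter> normalizer G K = {}"
    by (auto simp: l_coset_def)
  moreover have "K \<subseteq> conj_set G (\<nu> \<otimes> g) H"
  proof -
    have "conj_set G \<nu> K \<subseteq> conj_set G \<nu> (conj_set G g H)"
      using Kg by (auto simp: conj_set_eq_image)
    also have "\<dots> = conj_set G (\<nu> \<otimes> g) H"
      using \<nu>_closed g subgroup.mem_carrier[OF H]
      by (auto simp: conj_set_eq_image image_image m_assoc inv_mult_group intro!: image_cong)
    finally show ?thesis by (simp add: conj_K)
  qed
  ultimately show ?thesis
    using K H g KH \<nu>_closed by (simp add: homoclinic_triple_def)
qed

section \<open>Multiplication rules for rotations and reflections\<close>

locale dihedral = group G for G (structure) +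
  fixes m :: nat and \<rho> \<kappa> :: 'a
  assumes dihedral: "dihedral_group G m \<rho> \<kappa>" and m_pos: "m > 0"
begin

text \<open>Exponents are integers rather than residues, so the product rules for \<open>rot\<close>
  and \<open>ref\<close> involve no reduction modulo \<open>m\<close>; equality of elements then
  becomes congruence of exponents.\<close>

definition rot :: "int \<Rightarrow> 'a" where
  "rot a = \<rho> [^] a"

definition ref :: "int \<Rightarrow> 'a" where
  "ref a = rot a \<otimes> \<kappa>"

definition dih :: "nat \<Rightarrow> 'a set" where
  "dih d = rot ` {a. int d dvd a} \<union> ref ` {a. int d dvd a}"

lemma rho_closed: "\<rho> \<in> carrier G" and kappa_closed: "\<kappa> \<in> carrier G"
  and ord_rho: "ord \<rho> = m" and kappa_kappa: "\<kappa> \<otimes> \<kappa> = \<one>"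
  and rho_kappa: "\<rho> \<otimes> \<kappa> = \<kappa> \<otimes> inv \<rho>"
  and kappa_notin: "\<kappa> \<notin> generate G {\<rho>}"
  and generate_rho_kappa: "generate G {\<rho>, \<kappa>} = carrier G"
  using dihedral by (auto simp: dihedral_group_def)

lemma rot_closed [simp]: "rot a \<in> carrier G"
  by (simp add: rot_def rho_closed)

lemma ref_closed [simp]: "ref a \<in> carrier G"
  by (simp add: ref_def kappa_closed)

lemma rot_0: "rot 0 = \<one>" and ref_0: "ref 0 = \<kappa>"
  by (simp_all add: rot_def ref_def kappa_closed)

lemma rot_1: "rot 1 = \<rho>"
  by (simp add: rot_def rho_closed)

lemma rot_rot [simp]: "rot a \<otimes> rot b = rot (a + b)"
  by (simp add: rot_def rho_closed int_pow_mult)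

lemma rot_ref [simp]: "rot a \<otimes> ref b = ref (a + b)"
  by (simp add: ref_def kappa_closed flip: rot_rot m_assoc)

lemma inv_rot [simp]: "inv (rot a) = rot (- a)"
  by (simp add: rot_def rho_closed int_pow_neg)

lemma kappa_rot: "\<kappa> \<otimes> rot a = ref (- a)"
proof -
  have one: "\<kappa> \<otimes> rot (- 1) = rot 1 \<otimes> \<kappa>"
    using rho_kappa by (simp add: rot_def rho_closed int_pow_neg)
  have minus_one: "\<kappa> \<otimes> rot 1 = rot (- 1) \<otimes> \<kappa>"
  proof -
    \<comment> \<open>The defining relation moves \<open>\<kappa>\<close> past
      \<open>inv \<rho>\<close>; the two-sided induction below also has to move it past
      \<open>\<rho>\<close>, which is obtained by cancelling \<open>rot 1\<close> on the
      left.\<close>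
    have "rot 1 \<otimes> (\<kappa> \<otimes> rot 1) = \<kappa> \<otimes> (rot (- 1) \<otimes> rot 1)"
      by (simp only: one kappa_closed rot_closed flip: m_assoc)
    also have "\<dots> = rot 1 \<otimes> (rot (- 1) \<otimes> \<kappa>)"
      by (simp add: rot_0 kappa_closed flip: m_assoc)
    finally show ?thesis
      by (simp add: kappa_closed)
  qed
  show ?thesis
  proof (induction a rule: int_induct[where k = 0])
    case base
    thus ?case by (simp add: ref_def rot_0 kappa_closed)
  next
    case (step1 i)
    have "\<kappa> \<otimes> rot (i + 1) = (\<kappa> \<otimes> rot i) \<otimes> rot 1"
      by (simp add: kappa_closed m_assoc)
    also have "\<dots> = rot (- i) \<otimes> (rot (- 1) \<otimes> \<kappa>)"
      by (simp add: step1.IH ref_def kappa_closed m_assoc minus_one del: rot_rot)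
    also have "\<dots> = ref (- (i + 1))"
      by (simp add: ref_def kappa_closed flip: m_assoc)
    finally show ?case .
  next
    case (step2 i)
    have "\<kappa> \<otimes> rot (i - 1) = (\<kappa> \<otimes> rot i) \<otimes> rot (- 1)"
      by (simp add: kappa_closed m_assoc)
    also have "\<dots> = rot (- i) \<otimes> (rot 1 \<otimes> \<kappa>)"
      by (simp add: step2.IH ref_def kappa_closed m_assoc one del: rot_rot)
    also have "\<dots> = ref (- (i - 1))"
      by (simp add: ref_def kappa_closed flip: m_assoc)
    finally show ?case .
  qed
qed

lemma ref_rot [simp]: "ref a \<otimes> rot b = ref (a - b)"
  using kappa_rot[of b] by (simp add: ref_def[of a] kappa_closed m_assoc)

lemma ref_ref [simp]: "ref a \<otimes> ref b = rot (a - b)"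
proof -
  have "ref a \<otimes> ref b = ref a \<otimes> rot b \<otimes> \<kappa>"
    by (simp only: ref_def[of b] m_assoc[OF ref_closed rot_closed kappa_closed])
  also have "\<dots> = ref (a - b) \<otimes> \<kappa>"
    by simp
  also have "\<dots> = rot (a - b)"
    by (simp add: ref_def m_assoc kappa_closed kappa_kappa)
  finally show ?thesis .
qed

lemma inv_ref [simp]: "inv (ref a) = ref a"
  by (rule inv_equality) (simp_all add: rot_0)

lemma rot_eq_rot_iff: "rot a = rot b \<longleftrightarrow> int m dvd a - b"
  using int_pow_eq[OF rho_closed, of a b] by (simp add: rot_def ord_rho dvd_diff_commute)

lemma ref_eq_ref_iff: "ref a = ref b \<longleftrightarrow> int m dvd a - b"
  by (simp add: ref_def kappa_closed rot_eq_rot_iff)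

lemma generate_rho: "generate G {\<rho>} = range rot"
  by (auto simp: generate_pow[OF rho_closed] rot_def)

lemma rot_neq_ref: "rot a \<noteq> ref b"
proof
  assume "rot a = ref b"
  hence "rot (- b) \<otimes> rot a = rot (- b) \<otimes> ref b"
    by simp
  hence "\<kappa> = rot (a - b)"
    by (simp add: ref_0)
  thus False
    using kappa_notin by (auto simp: generate_rho)
qed

text \<open>The product rules make the union a subgroup, and it contains both generators.\<close>

lemma carrier_eq: "carrier G = range rot \<union> range ref"
proof
  have "subgroup (range rot \<union> range ref) G"
    by (rule subgroupI) auto
  moreover have "\<rho> \<in> range rot" and "\<kappa> \<in> range ref"
    using rot_1 ref_0 by (metis rangeI)+
  ultimately show "carrier G \<subseteq> range rot \<union> range ref"
    by (subst generate_rho_kappa[symmetric], intro generate_subgroup_incl) blast+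
qed auto

lemma carrier_cases [consumes 1, case_names rot ref]:
  assumes "x \<in> carrier G"
  obtains a where "x = rot a" | a where "x = ref a"
  using assms by (auto simp: carrier_eq)

lemma reflections_eq: "reflections G \<rho> = range ref"
  using rot_neq_ref rot_neq_ref[symmetric] by (auto simp: reflections_def generate_rho carrier_eq)

text \<open>The products of rotations with \<open>\<sigma>\<close> are all the reflections, so
  \<open>\<rho>\<close> and \<open>\<sigma>\<close> generate the group. Hence the whole locale is
  available with any reflection in place of \<open>\<kappa>\<close>, in particular with one found in
  \<open>K\<close>.\<close>

lemma dihedral_reflection:
  assumes "\<sigma> \<in> reflections G \<rho>"
  shows "dihedral G m \<rho> \<sigma>"
proof -
  obtain a where \<sigma>: "\<sigma> = ref a"
    using assms by (auto simp: reflections_eq)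
  let ?S = "generate G {\<rho>, \<sigma>}"
  have sub: "subgroup ?S G"
    by (rule generate_is_subgroup) (auto simp: rho_closed \<sigma>)
  have rot_S: "rot b \<in> ?S" for b
    using subgroup_int_pow_closed[OF sub, of \<rho> b] by (simp add: rot_def generate.incl)
  have "ref b \<in> ?S" for b
  proof -
    have "rot (b - a) \<otimes> \<sigma> \<in> ?S"
      using rot_S by (intro generate.eng) (auto intro: generate.incl)
    thus ?thesis by (simp add: \<sigma>)
  qed
  with rot_S have "?S = carrier G"
    using subgroup.subset[OF sub] by (auto simp: carrier_eq)
  moreover have "rot 1 \<otimes> \<sigma> = \<sigma> \<otimes> inv (rot 1)" and "\<sigma> \<otimes> \<sigma> = \<one>"
    by (simp_all add: \<sigma> rot_0 add.commute)
  ultimately have "dihedral_group G m \<rho> \<sigma>"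
    using dihedral assms unfolding rot_1 by (auto simp: dihedral_group_def reflections_def)
  thus ?thesis
    using m_pos by unfold_locales
qed

section \<open>The subgroups generated by the reflection and a power of the rotation\<close>

lemma dih_subset: "dih d \<subseteq> carrier G"
  by (auto simp: dih_def)

lemma kappa_in_dih: "\<kappa> \<in> dih d"
proof -
  have "ref 0 \<in> dih d" by (simp add: dih_def)
  thus ?thesis by (simp only: ref_0)
qed

text \<open>An element determines its exponent only modulo \<open>m\<close>. Membership in the image
  can be read off from \<open>a\<close> because, by assumption, \<open>A\<close> contains
  \<open>a\<close> once it contains an exponent congruent to \<open>a\<close>.\<close>

lemma rot_image_iff:
  assumes "\<And>b. int m dvd b - a \<Longrightarrow> b \<in> A \<Longrightarrow> a \<in> A"
  shows "rot a \<in> rot ` A \<union> ref ` B \<longleftrightarrow> a \<in> A"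
  using assms rot_neq_ref by (auto simp: rot_eq_rot_iff image_iff dvd_diff_commute intro: bexI[of _ a])

lemma ref_image_iff:
  assumes "\<And>b. int m dvd b - a \<Longrightarrow> b \<in> B \<Longrightarrow> a \<in> B"
  shows "ref a \<in> rot ` A \<union> ref ` B \<longleftrightarrow> a \<in> B"
  using assms rot_neq_ref[symmetric] by (auto simp: ref_eq_ref_iff image_iff dvd_diff_commute intro: bexI[of _ a])

lemma residue_class_closed:
  assumes "d dvd m" "int m dvd b - a" "int d dvd b - c"
  shows "int d dvd a - c"
proof -
  have "int d dvd (b - c) - (b - a)"
    using assms by (meson dvd_diff dvd_trans int_dvd_int_iff)
  thus ?thesis by simp
qed

text \<open>Since \<open>d\<close> divides \<open>m\<close>, a residue class modulo \<open>d\<close>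
  is a union of classes modulo \<open>m\<close>. Cosets and conjugates of \<open>dih d\<close> have
  exponent sets of this kind.\<close>

lemma mem_residue_classes_iff:
  assumes "d dvd m"
  shows "rot a \<in> rot ` {a. int d dvd a - c} \<union> ref ` B \<longleftrightarrow> int d dvd a - c"
    and "ref a \<in> rot ` B \<union> ref ` {a. int d dvd a - c} \<longleftrightarrow> int d dvd a - c"
proof -
  show "rot a \<in> rot ` {a. int d dvd a - c} \<union> ref ` B \<longleftrightarrow> int d dvd a - c"
    by (subst rot_image_iff) (use residue_class_closed[OF assms] in auto)
  show "ref a \<in> rot ` B \<union> ref ` {a. int d dvd a - c} \<longleftrightarrow> int d dvd a - c"
    by (subst ref_image_iff) (use residue_class_closed[OF assms] in auto)
qed

lemma mem_dih_iff:
  assumes "d dvd m"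
  shows "rot a \<in> dih d \<longleftrightarrow> int d dvd a" and "ref a \<in> dih d \<longleftrightarrow> int d dvd a"
  using mem_residue_classes_iff[OF assms, where a = a and c = 0] by (simp_all add: dih_def)

lemma subgroup_dih: "subgroup (dih d) G"
proof (rule subgroupI)
  show "dih d \<noteq> {}" using kappa_in_dih by blast
qed (auto simp: dih_def)

lemma rot_mult_pow: "rot (int d * k) = (\<rho> [^] d) [^] k"
  by (simp add: rot_def int_pow_pow rho_closed flip: int_pow_int)

lemma generate_kappa_rho_pow: "generate G {\<kappa>, \<rho> [^] d} = dih d"
proof
  have "\<rho> [^] d = rot (int d)"
    by (simp add: rot_def int_pow_int)
  thus "generate G {\<kappa>, \<rho> [^] d} \<subseteq> dih d"
    using kappa_in_dih by (intro generate_subgroup_incl subgroup_dih) (auto simp: dih_def)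
  let ?S = "generate G {\<kappa>, \<rho> [^] d}"
  have sub: "subgroup ?S G"
    by (rule generate_is_subgroup) (auto simp: rho_closed kappa_closed)
  have "rot (int d * k) \<in> ?S" for k
    unfolding rot_mult_pow by (rule subgroup_int_pow_closed[OF sub]) (auto intro: generate.incl)
  moreover from this have "ref (int d * k) \<in> ?S" for k
    unfolding ref_def by (intro generate.eng) (auto intro: generate.incl)
  ultimately show "dih d \<subseteq> ?S"
    by (auto simp: dih_def elim!: dvdE)
qed

text \<open>By division with remainder, the rotations in \<open>H\<close> are the powers of the one
  with least positive exponent; right multiplication by \<open>\<kappa>\<close> matches them with
  the reflections in \<open>H\<close>.\<close>

lemma subgroup_eq_dih:
  assumes sub: "subgroup H G" and kappa: "\<kappa> \<in> H"
  obtains d where "d dvd m" "H = dih d"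
proof -
  define d where "d = (LEAST d. d > 0 \<and> rot (int d) \<in> H)"
  have rot_m: "rot (int m) = \<one>"
    using rot_eq_rot_iff[of "int m" 0] by (simp add: rot_0)
  \<comment> \<open>The exponent \<open>m\<close> itself is a candidate, so the least one
    exists.\<close>
  have "m > 0 \<and> rot (int m) \<in> H"
    using m_pos subgroup.one_closed[OF sub] by (simp add: rot_m)
  hence d: "d > 0 \<and> rot (int d) \<in> H"
    unfolding d_def by (rule LeastI)
  have mult: "rot (int d * k) \<in> H" for k
    using subgroup_int_pow_closed[OF sub, of "rot (int d)" k] d
    by (simp add: rot_def int_pow_pow rho_closed)
  have iff: "rot a \<in> H \<longleftrightarrow> int d dvd a" for a
  proof
    assume "rot a \<in> H"
    hence "rot a \<otimes> rot (int d * - (a div int d)) \<in> H"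
      using mult by (intro subgroup.m_closed[OF sub])
    hence "rot (a mod int d) \<in> H"
      by (simp add: minus_mult_div_eq_mod)
    hence "\<not> nat (a mod int d) > 0"
      using d not_less_Least[of "nat (a mod int d)" "\<lambda>d. d > 0 \<and> rot (int d) \<in> H"]
      by (auto simp: nat_less_iff simp flip: d_def)
    moreover have "a mod int d \<ge> 0"
      using d by simp
    ultimately show "int d dvd a"
      by (simp add: dvd_eq_mod_eq_0)
  qed (use mult in auto)
  have ref_0_H: "ref 0 \<in> H"
    using kappa by (simp only: ref_0)
  have ref_iff: "ref a \<in> H \<longleftrightarrow> rot a \<in> H" for a
    using subgroup.m_closed[OF sub, of "ref a" "ref 0"] subgroup.m_closed[OF sub, of "rot a" "ref 0"]
    by (auto simp: ref_0_H)
  have "H = dih d"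
    using subgroup.subset[OF sub] by (auto simp: dih_def carrier_eq iff ref_iff)
  moreover have "d dvd m"
    using iff[of "int m"] subgroup.one_closed[OF sub] by (simp add: rot_m)
  ultimately show thesis by (rule that[rotated])
qed

section \<open>Conjugates, normalizers and cosets of these subgroups, and the criterion for
  homoclinic triples\<close>

lemma conj_set_dih:
  assumes "x \<in> {rot r, ref r}"
  shows "conj_set G x (dih d) = rot ` {a. int d dvd a} \<union> ref ` {a. int d dvd a - 2 * r}"
proof -
  \<comment> \<open>\<open>rot r\<close> fixes rotations and sends \<open>ref a\<close> to
    \<open>ref (2 * r + a)\<close>; \<open>ref r\<close> inverts rotations and sends
    \<open>ref a\<close> to \<open>ref (2 * r - a)\<close>. The two conjugates agree because the
    multiples of \<open>d\<close> are closed under negation.\<close>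
  let ?A = "{a. int d dvd a}"
  have minus: "uminus ` ?A = ?A"
    by (auto simp: image_iff) (metis dvd_minus_iff minus_minus)
  have plus: "(\<lambda>a. 2 * r + a) ` ?A = {a. int d dvd a - 2 * r}"
    by (auto simp: image_iff) (metis add.commute diff_add_cancel)
  have "(\<lambda>a. 2 * r - a) ` ?A = (\<lambda>a. 2 * r + a) ` uminus ` ?A"
    by (simp add: image_image)
  hence diff: "(\<lambda>a. 2 * r - a) ` ?A = {a. int d dvd a - 2 * r}"
    by (simp only: minus plus)
  consider "x = rot r" | "x = ref r"
    using assms by blast
  thus ?thesis
  proof cases
    case 1
    hence "conj_set G x (dih d) = rot ` ?A \<union> ref ` (\<lambda>a. 2 * r + a) ` ?A"
      by (simp add: conj_set_eq_image dih_def image_Un image_image algebra_simps)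
    thus ?thesis by (simp only: plus)
  next
    case 2
    hence "conj_set G x (dih d) = rot ` uminus ` ?A \<union> ref ` (\<lambda>a. 2 * r - a) ` ?A"
      by (simp add: conj_set_eq_image dih_def image_Un image_image algebra_simps)
    thus ?thesis by (simp only: minus diff)
  qed
qed

lemma mem_normalizer_dih_iff:
  assumes "d dvd m" "x \<in> {rot r, ref r}"
  shows "x \<in> normalizer G (dih d) \<longleftrightarrow> int d dvd 2 * r"
proof -
  have "conj_set G x (dih d) = dih d \<longleftrightarrow> int d dvd 2 * r"
  proof
    assume *: "conj_set G x (dih d) = dih d"
    \<comment> \<open>For either form of \<open>x\<close>, \<open>ref (2 * r)\<close> is the
      conjugate of \<open>\<kappa>\<close> by \<open>x\<close>.\<close>
    have "ref (2 * r) \<in> conj_set G x (dih d)"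
      by (simp add: conj_set_dih[OF assms(2)])
    thus "int d dvd 2 * r"
      by (simp add: * mem_dih_iff assms(1))
  next
    assume "int d dvd 2 * r"
    hence "int d dvd a - 2 * r \<longleftrightarrow> int d dvd a" for a
      by (metis diff_add_cancel dvd_add dvd_diff)
    thus "conj_set G x (dih d) = dih d"
      unfolding conj_set_dih[OF assms(2)] by (simp add: dih_def)
  qed
  thus ?thesis
    using assms(2) by (auto simp: mem_normalizer_iff[OF dih_subset])
qed

lemma l_coset_dih: "rot r <# dih d = rot ` {a. int d dvd a - r} \<union> ref ` {a. int d dvd a - r}"
proof -
  have "(\<lambda>a. r + a) ` {a. int d dvd a} = {a. int d dvd a - r}"
    by (auto simp: image_iff) (metis add.commute diff_add_cancel)
  moreover have "rot r <# dih d = rot ` (\<lambda>a. r + a) ` {a. int d dvd a} \<union> ref ` (\<lambda>a. r + a) ` {a. int d dvd a}"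
    by (auto simp: l_coset_def dih_def)
  ultimately show ?thesis by simp
qed

text \<open>For (HT1), the coset consists of the \<open>rot a\<close> and \<open>ref a\<close> with
  \<open>a\<close> congruent to \<open>r\<close> modulo \<open>e\<close>, and each of them
  normalizes \<open>dih d\<close> iff \<open>d\<close> divides \<open>2 * a\<close>. For (HT2), the
  inclusions are tested on generators: \<open>rot (int d)\<close> yields \<open>e dvd d\<close>, and
  \<open>\<kappa>\<close> yields \<open>int e dvd 2 * r\<close>.\<close>

lemma homoclinic_triple_dih_iff:
  assumes d: "d dvd m" and e: "e dvd m"
  shows "homoclinic_triple G (dih d, rot r, dih e) \<longleftrightarrow>
    e dvd d \<and> int e dvd 2 * r \<and> (\<forall>a. int e dvd a - r \<longrightarrow> \<not> int d dvd 2 * a)"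
proof -
  have "(rot r <# dih e) \<inter> normalizer G (dih d) = {} \<longleftrightarrow>
      (\<forall>a. int e dvd a - r \<longrightarrow> \<not> int d dvd 2 * a)"
    using mem_normalizer_dih_iff[OF d, of "rot a" a for a] mem_normalizer_dih_iff[OF d, of "ref a" a for a]
    by (auto simp: l_coset_dih disjoint_iff)
  moreover have "dih d \<subseteq> dih e \<longleftrightarrow> e dvd d"
  proof
    assume "dih d \<subseteq> dih e"
    moreover have "rot (int d) \<in> dih d"
      by (simp add: mem_dih_iff d)
    ultimately have "rot (int d) \<in> dih e" by blast
    thus "e dvd d" by (simp add: mem_dih_iff e)
  next
    assume "e dvd d"
    hence "int e dvd int d" by simp
    thus "dih d \<subseteq> dih e"
      unfolding dih_def using dvd_trans by blast
  qed
  moreover have "dih d \<subseteq> conj_set G (rot r) (dih e) \<longleftrightarrow> int e dvd 2 * r" if "e dvd d"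
  proof
    assume "dih d \<subseteq> conj_set G (rot r) (dih e)"
    hence "ref 0 \<in> conj_set G (rot r) (dih e)"
      using kappa_in_dih[of d] by (auto simp: ref_0)
    hence "ref 0 \<in> rot ` {a. int e dvd a} \<union> ref ` {a. int e dvd a - 2 * r}"
      by (simp only: conj_set_dih[of "rot r" r] insert_iff simp_thms)
    thus "int e dvd 2 * r"
      using mem_residue_classes_iff(2)[OF e, of 0 _ "2 * r"] by simp
  next
    assume "int e dvd 2 * r"
    hence "int e dvd a - 2 * r" if "int d dvd a" for a
      using that \<open>e dvd d\<close> by (meson dvd_diff dvd_trans int_dvd_int_iff)
    moreover have "int e dvd a" if "int d dvd a" for a
      using that \<open>e dvd d\<close> by (meson dvd_trans int_dvd_int_iff)
    ultimately show "dih d \<subseteq> conj_set G (rot r) (dih e)"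
      by (auto simp: conj_set_dih[of "rot r" r] dih_def[of d])
  qed
  ultimately show ?thesis
    by (auto simp: homoclinic_triple_def subgroup_dih)
qed

text \<open>Rotations commute with the elements of \<open>K\<close> and reflections invert them.
  Such a \<open>K\<close> violates (HT1) for every \<open>g\<close>, which forces a reflection into
  the \<open>K\<close> of a homoclinic triple.\<close>

lemma normalizer_rotations:
  assumes "subgroup K G" "K \<subseteq> range rot"
  shows "normalizer G K = carrier G"
proof -
  have "conj_set G x K = K" if "x \<in> carrier G" for x
    using that
  proof (cases rule: carrier_cases)
    case (rot a)
    have "rot a \<otimes> y \<otimes> inv (rot a) = y" if "y \<in> K" for y
      using that assms(2) by auto
    thus ?thesis
      by (simp add: conj_set_eq_image rot)
  next
    case (ref a)
    have "ref a \<otimes> y \<otimes> inv (ref a) = inv y" if "y \<in> K" for y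
      using that assms(2) by auto
    hence "conj_set G x K = m_inv G ` K"
      by (simp add: conj_set_eq_image ref)
    also have "\<dots> = K"
      using subgroup.m_inv_closed[OF assms(1)] subgroup.mem_carrier[OF assms(1)]
      by (force simp: image_iff intro: bexI[of _ "inv _"])
    finally show ?thesis .
  qed
  thus ?thesis
    using subgroup.subset[OF assms(1)] by (auto simp: mem_normalizer_iff)
qed

end

section \<open>Divisibility and powers of two\<close>

lemma multiplicity_two_int: "multiplicity 2 (int k) = multiplicity 2 k"
proof -
  have "2 ^ j dvd int k \<longleftrightarrow> 2 ^ j dvd k" for j
    by (metis int_dvd_int_iff of_nat_numeral of_nat_power)
  thus ?thesis by (simp add: multiplicity_def)
qed

text \<open>Both directions use \<open>s = e div 2\<close>, which is \<open>2 * n div p\<close>, and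
  \<open>u = d div e\<close>, which is \<open>p div q\<close>. In each of them \<open>r\<close> is
  an odd multiple of \<open>s\<close>, so \<open>t(r) = t(s)\<close>, and the crux is that
  \<open>u\<close> is even.\<close>

lemma homoclinic_arith:
  fixes n p q :: nat and r :: int
  assumes n: "n > 0" and p: "p dvd 4 * n" and q: "q dvd 4 * n"
  defines "d \<equiv> 4 * n div q" and "e \<equiv> 4 * n div p"
  shows "e dvd d \<and> int e dvd 2 * r \<and> (\<forall>a. int e dvd a - r \<longrightarrow> \<not> int d dvd 2 * a) \<longleftrightarrow>
    q dvd n \<and> multiplicity 2 r \<le> multiplicity 2 (n div q) \<and> q dvd p \<and> q \<noteq> p \<and>
    p dvd 2 * n \<and> [r = int (2 * n div p)] (mod int (4 * n div p))"
    (is "?L \<longleftrightarrow> ?R")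
proof
  have q_pos: "q > 0" and p_pos: "p > 0"
    using n p q by (auto intro: Nat.gr0I)
  have qd: "4 * n = q * d" and pe: "4 * n = p * e"
    using p q by (simp_all add: d_def e_def)
  {
    assume L: ?L
    then obtain u where u: "d = e * u" by blast
    have pqu: "p = q * u"
      using qd pe n by (auto simp: u)
    have "\<not> int e dvd r"
    proof
      assume "int e dvd r"
      \<comment> \<open>The instance \<open>a = 0\<close>, for which \<open>d\<close> divides
        \<open>2 * a\<close>, excludes that \<open>e\<close> divides \<open>r\<close>.\<close>
      hence "int e dvd 0 - r" by simp
      hence "\<not> int d dvd 2 * 0" using L by blast
      thus False by simp
    qed
    have "even e"
    proof (rule ccontr)
      assume "odd e"
      hence "coprime (int e) 2" by simp
      thus False
        using L \<open>\<not> int e dvd r\<close> by (simp add: coprime_dvd_mult_right_iff)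
    qed
    then obtain s where s: "e = 2 * s" by blast
    have "int s dvd r"
      using L by (simp add: s)
    then obtain w where w: "r = int s * w" by blast
    have "s > 0"
      using pe n s by (auto intro: Nat.gr0I)
    have "odd w"
      using \<open>\<not> int e dvd r\<close> by (auto simp: w s)
    have "even u"
    proof (rule ccontr)
      assume "odd u"
      hence "even (int u - w)"
        using \<open>odd w\<close> by simp
      then obtain k where k: "int u - w = 2 * k" by blast
      \<comment> \<open>The witness against odd \<open>u\<close> is \<open>a = s * u\<close>, half
        of \<open>d\<close>: doubling it gives \<open>d\<close>, and it is congruent to
        \<open>r\<close> modulo \<open>e = 2 * s\<close> because \<open>u - w\<close> is
        even.\<close>
      have "int e dvd int s * int u - r"
      proof -
        have "int s * int u - r = int s * (int u - w)"
          by (simp add: w right_diff_distrib)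
        also have "\<dots> = int e * k"
          by (simp add: k s)
        finally show ?thesis by simp
      qed
      moreover have "int d dvd 2 * (int s * int u)"
        by (simp add: u s)
      ultimately show False using L by blast
    qed
    then obtain v where v: "u = 2 * v" by blast
    have n_eq: "n = q * (v * s)" and n2: "2 * n = p * s"
      using qd by (simp_all add: u v s pqu)
    have "multiplicity 2 r = multiplicity 2 (int s) + multiplicity 2 w"
      unfolding w using \<open>odd w\<close> \<open>s > 0\<close>
      by (intro prime_elem_multiplicity_mult_distrib) auto
    also have "\<dots> = multiplicity 2 s"
      using \<open>odd w\<close> by (simp add: not_dvd_imp_multiplicity_0 multiplicity_two_int)
    \<comment> \<open>\<open>s\<close> divides \<open>n div q\<close>, which equals
      \<open>v * s\<close>.\<close>
    also have "\<dots> \<le> multiplicity 2 (n div q)"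
      using n n_eq q_pos by (intro dvd_imp_multiplicity_le) auto
    finally have "multiplicity 2 r \<le> multiplicity 2 (n div q)" .
    moreover have "int e dvd r - int s"
    proof -
      have "even (w - 1)" using \<open>odd w\<close> by simp
      hence "int s * 2 dvd int s * (w - 1)" by (intro mult_dvd_mono) auto
      thus ?thesis by (simp add: w s algebra_simps)
    qed
    hence "[r = int (2 * n div p)] (mod int (4 * n div p))"
      using p_pos by (simp add: cong_iff_dvd_diff n2 flip: e_def)
    moreover have "q dvd n" "q dvd p" "p dvd 2 * n"
      unfolding n2 by (simp_all add: n_eq pqu)
    moreover have "q \<noteq> p"
      using q_pos by (simp add: pqu v)
    ultimately show ?R by blast
  }
  {
    assume R: ?R
    then obtain s u v where s: "2 * n = p * s" and u: "p = q * u" and v: "n = q * v"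
      by (auto elim!: dvdE)
    have "p * e = 2 * (p * s)"
      by (simp flip: pe s)
    hence e: "e = 2 * s"
      using p_pos by simp
    \<comment> \<open>In this direction \<open>v\<close> denotes \<open>n div q\<close>; computing
      \<open>2 * n\<close> from \<open>q\<close> and from \<open>p\<close> gives
      \<open>2 * v = u * s\<close>.\<close>
    have d: "d = e * u" and uv: "2 * v = u * s"
      using qd s u v p_pos q_pos by (auto simp: e)
    have "s > 0" "v > 0"
      using s v n by (auto intro: Nat.gr0I)
    have "int e dvd r - int s"
      using R p_pos by (simp add: cong_iff_dvd_diff s flip: e_def)
    then obtain t where "r - int s = int e * t" by blast
    hence r: "r = int s * (1 + 2 * t)"
      by (simp add: e algebra_simps)
    have "multiplicity 2 r = multiplicity 2 (int s) + multiplicity 2 (1 + 2 * t)"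
      unfolding r using \<open>s > 0\<close> by (intro prime_elem_multiplicity_mult_distrib) (simp | presburger)+
    also have "\<dots> = multiplicity 2 s"
      by (simp add: not_dvd_imp_multiplicity_0 multiplicity_two_int)
    finally have le: "multiplicity 2 s \<le> multiplicity 2 v"
      using R q_pos by (simp add: v)
    have "even u"
    proof (rule ccontr)
      assume odd: "odd u"
      \<comment> \<open>Odd \<open>u\<close> would give
        \<open>t(v) + 1 = t(2 * v) = t(u * s) = t(s)\<close>, against the inequality (ii).\<close>
      have "Suc (multiplicity 2 v) = multiplicity 2 (u * s)"
        using \<open>v > 0\<close> by (simp add: prime_elem_multiplicity_mult_distrib flip: uv)
      also have "\<dots> = multiplicity 2 u + multiplicity 2 s"
        using odd \<open>s > 0\<close> by (intro prime_elem_multiplicity_mult_distrib) (auto simp: odd_pos)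
      also have "\<dots> = multiplicity 2 s"
        using odd by (simp add: not_dvd_imp_multiplicity_0)
      finally show False using le by simp
    qed
    \<comment> \<open>\<open>2 * a\<close> is an odd multiple of \<open>2 * s\<close>, whereas
      \<open>d = 2 * s * u\<close> is an even one.\<close>
    moreover have False if ea: "int e dvd a - r" and da: "int d dvd 2 * a" and "even u" for a
    proof -
      obtain k where "a - r = int e * k" using ea by (rule dvdE)
      hence "a = r + int e * k"
        by simp
      also have "\<dots> = int s * (1 + 2 * t + 2 * k)"
        by (simp add: r e distrib_left)
      finally have a: "2 * a = (2 * int s) * (1 + 2 * t + 2 * k)"
        by simp
      obtain u' where "u = 2 * u'" using \<open>even u\<close> by (rule evenE)
      hence "int d = (2 * int s) * (2 * int u')"
        by (simp add: d e)
      with da have "(2 * int s) * (2 * int u') dvd (2 * int s) * (1 + 2 * t + 2 * k)"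
        by (simp only: a)
      hence "2 * int u' dvd 1 + 2 * t + 2 * k"
        using \<open>s > 0\<close> by (subst (asm) dvd_mult_cancel_left) simp
      hence "even (1 + 2 * t + 2 * k)"
        by (rule dvd_mult_left)
      thus False by simp
    qed
    moreover have "int e dvd 2 * r"
      by (simp add: e r)
    moreover have "e dvd d"
      by (simp add: d)
    ultimately show ?L by blast
  }
qed

section \<open>Reduction of homoclinic triples to standard form\<close>

theorem theorem3p5:
  fixes G :: "('a, 'b) monoid_scheme" and n :: nat and \<rho> \<kappa> :: 'a
  assumes "n \<ge> 1" and "dihedral_group G (4 * n) \<rho> \<kappa>"
  shows "(\<forall>T. homoclinic_triple G T \<longrightarrow>
              (\<exists>T' \<in> standard_triples G n \<rho>. homoclinic_equiv G T T')) \<and>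
         (\<forall>T \<in> standard_triples G n \<rho>. homoclinic_triple G T)"
proof -
  have every_reflection: "dihedral G (4 * n) \<rho> \<sigma>" if "\<sigma> \<in> reflections G \<rho>" for \<sigma>
  proof -
    interpret dihedral G "4 * n" \<rho> \<kappa>
      using assms by (auto simp: dihedral_def dihedral_axioms_def dihedral_group_def)
    show ?thesis using that by (rule dihedral_reflection)
  qed
  have div_dvd: "N div q dvd N" if "q dvd N" for q N :: nat
    using that by (metis dvd_mult_div_cancel dvd_triv_right)
  \<comment> \<open>One equivalence serves both halves: from right to left it verifies the standard
    triples, from left to right it yields (i)-(iii) for a triple already brought into this
    shape.\<close>
  have standard: "homoclinic_triple G (dihedral_subgroup G (4 * n) \<rho> \<sigma> q, \<rho> [^]\<^bsub>G\<^esub> r,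
        dihedral_subgroup G (4 * n) \<rho> \<sigma> p) \<longleftrightarrow>
      q dvd n \<and> multiplicity 2 r \<le> multiplicity 2 (n div q) \<and> q dvd p \<and> q \<noteq> p \<and>
      p dvd 2 * n \<and> [r = int (2 * n div p)] (mod int (4 * n div p))"
    if \<sigma>: "\<sigma> \<in> reflections G \<rho>" and p: "p dvd 4 * n" and q: "q dvd 4 * n" for \<sigma> p q and r :: int
  proof -
    interpret D: dihedral G "4 * n" \<rho> \<sigma>
      using \<sigma> by (rule every_reflection)
    have "homoclinic_triple G (dihedral_subgroup G (4 * n) \<rho> \<sigma> q, \<rho> [^]\<^bsub>G\<^esub> r,
        dihedral_subgroup G (4 * n) \<rho> \<sigma> p) \<longleftrightarrow>
      homoclinic_triple G (D.dih (4 * n div q), D.rot r, D.dih (4 * n div p))"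
      by (simp add: dihedral_subgroup_def D.generate_kappa_rho_pow D.rot_def)
    also note D.homoclinic_triple_dih_iff[OF div_dvd[OF q] div_dvd[OF p]]
    also note homoclinic_arith[OF _ p q]
    finally show ?thesis using assms(1) by simp
  qed
  show ?thesis
  proof (intro conjI allI ballI impI)
    fix T assume "T \<in> standard_triples G n \<rho>"
    then obtain \<sigma> p q r where T: "T = (dihedral_subgroup G (4 * n) \<rho> \<sigma> q, \<rho> [^]\<^bsub>G\<^esub> (r :: int),
        dihedral_subgroup G (4 * n) \<rho> \<sigma> p)" and \<sigma>: "\<sigma> \<in> reflections G \<rho>" and
      *: "q dvd n \<and> multiplicity 2 r \<le> multiplicity 2 (n div q) \<and> q dvd p \<and> q \<noteq> p \<and>
        p dvd 2 * n \<and> [r = int (2 * n div p)] (mod int (4 * n div p))"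
      unfolding standard_triples_def by blast
    have "p dvd 2 * (2 * n)" "q dvd 4 * n"
      using * by (blast intro: dvd_mult)+
    hence "p dvd 4 * n" "q dvd 4 * n"
      by simp_all
    with \<sigma> * show "homoclinic_triple G T"
      unfolding T by (subst standard)
  next
    fix T assume hom: "homoclinic_triple G T"
    obtain K g H where T: "T = (K, g, H)" by (cases T)
    have K: "subgroup K G" and H: "subgroup H G" and g: "g \<in> carrier G"
      and disj: "(g <#\<^bsub>G\<^esub> H) \<inter> normalizer G K = {}" and KH: "K \<subseteq> H"
      using hom by (auto simp: T homoclinic_triple_def)
    interpret dihedral G "4 * n" \<rho> \<kappa>
      using assms by (auto simp: dihedral_def dihedral_axioms_def dihedral_group_def)
    \<comment> \<open>\<open>g\<close> lies in its own coset, so (HT1) keeps it out of the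
      normalizer. Hence \<open>K\<close> contains a reflection \<open>\<sigma>\<close>, which takes
      over the role of \<open>\<kappa>\<close>.\<close>
    have "g \<otimes>\<^bsub>G\<^esub> \<one>\<^bsub>G\<^esub> \<in> g <#\<^bsub>G\<^esub> H"
      using subgroup.one_closed[OF H] unfolding l_coset_def by blast
    hence "normalizer G K \<noteq> carrier G"
      using disj g by auto
    hence "\<not> K \<subseteq> range rot"
      using normalizer_rotations[OF K] by blast
    then obtain \<sigma> where \<sigma>: "\<sigma> \<in> K" "\<sigma> \<in> reflections G \<rho>"
      using subgroup.subset[OF K] by (auto simp: reflections_def generate_rho)
    interpret D: dihedral G "4 * n" \<rho> \<sigma>
      using \<sigma>(2) by (rule every_reflection)
    obtain d where d: "d dvd 4 * n" "K = D.dih d"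
      using D.subgroup_eq_dih[OF K] \<sigma>(1) by blast
    \<comment> \<open>By (HT2) the same \<open>\<sigma>\<close> lies in \<open>H\<close>, so one
      reflection describes both subgroups.\<close>
    obtain e where e: "e dvd 4 * n" "H = D.dih e"
      using D.subgroup_eq_dih[OF H] \<sigma>(1) KH by blast
    define q where "q = 4 * n div d"
    define p where "p = 4 * n div e"
    \<comment> \<open>The subgroups come with exponents \<open>d\<close> and \<open>e\<close>, the
      standard form with \<open>q\<close> and \<open>p\<close>. Since
      \<open>k \<mapsto> N div k\<close> is an involution on the divisors of \<open>N\<close>,
      \<open>4 * n div q\<close> gives back \<open>d\<close>, and likewise for \<open>p\<close> and
      \<open>e\<close>.\<close>
    have codivisor: "0 < N div k" "N div (N div k) = k" if k: "k dvd N" and N: "N > 0" for k N :: nat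
    proof -
      obtain l where l: "N = k * l" using k by blast
      hence "k > 0" "l > 0" using N by auto
      thus "0 < N div k" "N div (N div k) = k" by (simp_all add: l)
    qed
    have q: "q dvd 4 * n" "q > 0" "K = dihedral_subgroup G (4 * n) \<rho> \<sigma> q"
      using div_dvd[OF d(1)] codivisor[OF d(1)] d(2) assms(1)
      by (simp_all add: q_def dihedral_subgroup_def D.generate_kappa_rho_pow)
    have p: "p dvd 4 * n" "p > 0" "H = dihedral_subgroup G (4 * n) \<rho> \<sigma> p"
      using div_dvd[OF e(1)] codivisor[OF e(1)] e(2) assms(1)
      by (simp_all add: p_def dihedral_subgroup_def D.generate_kappa_rho_pow)
    obtain r :: int where r: "homoclinic_triple G (K, \<rho> [^]\<^bsub>G\<^esub> r, H)"
        "homoclinic_equiv G T (K, \<rho> [^]\<^bsub>G\<^esub> r, H)"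
      using g
    proof (cases rule: D.carrier_cases)
      case (rot a)
      thus thesis
        using hom by (intro that[of a]) (simp_all add: T D.rot_def homoclinic_equiv_def)
    next
      case (ref a)
      have \<sigma>_norm: "\<sigma> \<in> normalizer G K"
        using subgroup_subset_normalizer[OF K] \<sigma>(1) by blast
      \<comment> \<open>In the interpretation \<open>D\<close>, \<open>\<sigma>\<close> is
        \<open>D.ref 0\<close>, so its product with \<open>D.ref a\<close> is the rotation with
        exponent \<open>- a\<close>; a single normalizer step suffices.\<close>
      have eq: "\<sigma> \<otimes>\<^bsub>G\<^esub> g = \<rho> [^]\<^bsub>G\<^esub> (- a)"
        using D.ref_ref[of 0 a] by (simp add: ref D.ref_0 D.rot_def)
      have "homoclinic_step G T (K, \<rho> [^]\<^bsub>G\<^esub> (- a), H)"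
        using homoclinic_step.normalizer_mult[OF hom[unfolded T] \<sigma>_norm] by (simp only: T eq)
      moreover have "homoclinic_triple G (K, \<rho> [^]\<^bsub>G\<^esub> (- a), H)"
        using homoclinic_triple_normalizer_mult[OF hom[unfolded T] \<sigma>_norm] by (simp only: eq)
      ultimately show thesis
        by (intro that[of "- a"]) (auto simp: homoclinic_equiv_def)
    qed
    have "(K, \<rho> [^]\<^bsub>G\<^esub> r, H) \<in> standard_triples G n \<rho>"
      using r(1) standard[OF \<sigma>(2) p(1) q(1)] \<sigma>(2) p(2) q(2)
      unfolding standard_triples_def p(3) q(3) by blast
    thus "\<exists>T'\<in>standard_triples G n \<rho>. homoclinic_equiv G T T'"
      using r(2) by blast
  qed
qed

end
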